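(* Quantified orthologic does not admit quantifier elimination. In particular, there is no quantifier-free formula $E$ such that both $E\vdash \bigvee x.\big(\neg x\land(y\lor x)\big)$ and $\bigvee x.\big(\neg x\land(y\lor x)\big)\vdash E$ are provable in the QOL sequent calculus.
   Context: Formulas of QOL are built from propositional variables, constants $0,1$, connectives $\land,\lor,\neg$, and quantifiers $\bigwedge x.\phi$, $\bigvee x.\phi$, identified up to alpha-equivalence; $\phi[x:=\psi]$ is capture-avoiding substitution. An annotated formula is $\phi^L$ or $\phi^R$; a sequent is a set of at most two annotated formulas; $\Gamma,\Delta$ denote sets of zero or one annotated formula. $\phi\vdash\psi$ means the sequent $\phi^L,\psi^R$ is derivable from the rules: Hyp: $\phi^L,\phi^R$. Cut: from $\Gamma,\psi^R$ and $\psi^L,\Delta$ infer $\Gamma,\Delta$. Weaken: from $\Gamma$ infer $\Gamma,\Delta$. LeftAnd: from $\Gamma,\phi^L$ infer $\Gamma,(\phi\land\psi)^L$. RightAnd: from $\Gamma,\phi^R$ and $\Gamma,\psi^R$ infer $\Gamma,(\phi\land\psi)^R$. LeftOr: from $\Gamma,\phi^L$ and $\Gamma,\psi^L$ infer $\Gamma,(\phi\lor\psi)^L$. RightOr: from $\Gamma,\phi^R$ infer $\Gamma,(\phi\lor\psi)^R$. LeftNot: from $\Gamma,\phi^R$ infer $\Gamma,(\neg\phi)^L$. RightNot: from $\Gamma,\phi^L$ infer $\Gamma,(\neg\phi)^R$. LeftForall: from $\Gamma,\phi[x:=\gamma]^L$ infer $\Gamma,(\bigwedge x.\phi)^L$.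 RightForall: from $\Gamma,\phi[x:=x']^R$, $x'$ not free in $\Gamma$, infer $\Gamma,(\bigwedge x.\phi)^R$. LeftExists: from $\Gamma,\phi[x:=x']^L$, $x'$ not free in $\Gamma$, infer $\Gamma,(\bigvee x.\phi)^L$. RightExists: from $\Gamma,\phi[x:=\gamma]^R$ infer $\Gamma,(\bigvee x.\phi)^R$. A quantified propositional logic admits quantifier elimination if for every formula $Q$ there is a quantifier-free formula $E$ with $Q\vdash E$ and $E\vdash Q$.
   Formalization: In RightForall and LeftExists, x' must also not be free in the quantified formula (with freshness in Γ alone, y∨¬y gives ⋀x.(y∨¬x) and every formula becomes derivable); LeftAnd and RightOr apply to either component. *)

theory Defs
  imports Main
begin

section \<open>Formulas up to alpha-equivalence\<close>

text \<open>
  Alpha-equivalence classes of formulas are represented by de Bruijn terms: in the body of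
  \<open>DForall\<close> and \<open>DExists\<close> index 0 is the bound variable, and index \<open>Suc n\<close> stands for the
  variable that is \<open>n\<close> outside. At the top level \<open>Var n\<close> is the \<open>n\<close>-th propositional variable.
  All later notions use the named binders \<open>big_and x \<phi>\<close> and \<open>big_or x \<phi>\<close> below.
\<close>

type_synonym var = nat

datatype form =
    Var var
  | Zero
  | One
  | And form form
  | Or form form
  | Neg form
  | DForall form
  | DExists form

primrec free_vars :: "form \<Rightarrow> var set" where
  "free_vars (Var x) = {x}"
| "free_vars Zero = {}"
| "free_vars One = {}"
| "free_vars (And \<phi> \<psi>) = free_vars \<phi> \<union> free_vars \<psi>"
| "free_vars (Or \<phi> \<psi>) = free_vars \<phi> \<union> free_vars \<psi>"
| "free_vars (Neg \<phi>) = free_vars \<phi>"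
| "free_vars (DForall \<phi>) = {x. Suc x \<in> free_vars \<phi>}"
| "free_vars (DExists \<phi>) = {x. Suc x \<in> free_vars \<phi>}"

primrec quantifier_free :: "form \<Rightarrow> bool" where
  "quantifier_free (Var x) = True"
| "quantifier_free Zero = True"
| "quantifier_free One = True"
| "quantifier_free (And \<phi> \<psi>) = (quantifier_free \<phi> \<and> quantifier_free \<psi>)"
| "quantifier_free (Or \<phi> \<psi>) = (quantifier_free \<phi> \<and> quantifier_free \<psi>)"
| "quantifier_free (Neg \<phi>) = quantifier_free \<phi>"
| "quantifier_free (DForall \<phi>) = False"
| "quantifier_free (DExists \<phi>) = False"

definition lift_ren :: "(var \<Rightarrow> var) \<Rightarrow> var \<Rightarrow> var" where
  "lift_ren f = case_nat 0 (\<lambda>n. Suc (f n))"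

primrec rename :: "(var \<Rightarrow> var) \<Rightarrow> form \<Rightarrow> form" where
  "rename f (Var x) = Var (f x)"
| "rename f Zero = Zero"
| "rename f One = One"
| "rename f (And \<phi> \<psi>) = And (rename f \<phi>) (rename f \<psi>)"
| "rename f (Or \<phi> \<psi>) = Or (rename f \<phi>) (rename f \<psi>)"
| "rename f (Neg \<phi>) = Neg (rename f \<phi>)"
| "rename f (DForall \<phi>) = DForall (rename (lift_ren f) \<phi>)"
| "rename f (DExists \<phi>) = DExists (rename (lift_ren f) \<phi>)"

definition lift_subst :: "(var \<Rightarrow> form) \<Rightarrow> var \<Rightarrow> form" where
  "lift_subst s = case_nat (Var 0) (\<lambda>n. rename Suc (s n))"

primrec psubst :: "(var \<Rightarrow> form) \<Rightarrow> form \<Rightarrow> form" where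
  "psubst s (Var x) = s x"
| "psubst s Zero = Zero"
| "psubst s One = One"
| "psubst s (And \<phi> \<psi>) = And (psubst s \<phi>) (psubst s \<psi>)"
| "psubst s (Or \<phi> \<psi>) = Or (psubst s \<phi>) (psubst s \<psi>)"
| "psubst s (Neg \<phi>) = Neg (psubst s \<phi>)"
| "psubst s (DForall \<phi>) = DForall (psubst (lift_subst s) \<phi>)"
| "psubst s (DExists \<phi>) = DExists (psubst (lift_subst s) \<phi>)"

definition subst :: "form \<Rightarrow> var \<Rightarrow> form \<Rightarrow> form"  ("_[_ ::= _]" [1000, 0, 0] 1000) where
  "\<phi>[x ::= \<gamma>] = psubst (Var(x := \<gamma>)) \<phi>"

definition abstract :: "var \<Rightarrow> form \<Rightarrow> form" where
  "abstract x = rename (\<lambda>n. if n = x then 0 else Suc n)"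

definition big_and :: "var \<Rightarrow> form \<Rightarrow> form" where
  "big_and x \<phi> = DForall (abstract x \<phi>)"

definition big_or :: "var \<Rightarrow> form \<Rightarrow> form" where
  "big_or x \<phi> = DExists (abstract x \<phi>)"


subsection \<open>The named binders behave as binders modulo alpha-equivalence\<close>

lemma rename_cong:
  "(\<And>n. n \<in> free_vars \<phi> \<Longrightarrow> f n = g n) \<Longrightarrow> rename f \<phi> = rename g \<phi>"
proof (induction \<phi> arbitrary: f g)
  case (And \<phi> \<psi>)
  have "rename f \<phi> = rename g \<phi>" "rename f \<psi> = rename g \<psi>"
    by (rule And.IH, simp add: And.prems)+
  then show ?case by simp
next
  case (Or \<phi> \<psi>)
  have "rename f \<phi> = rename g \<phi>" "rename f \<psi> = rename g \<psi>"
    by (rule Or.IH, simp add: Or.prems)+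
  then show ?case by simp
next
  case (DForall \<phi>)
  have "rename (lift_ren f) \<phi> = rename (lift_ren g) \<phi>"
  proof (rule DForall.IH)
    fix n assume "n \<in> free_vars \<phi>"
    then show "lift_ren f n = lift_ren g n"
      using DForall.prems by (cases n) (simp_all add: lift_ren_def)
  qed
  then show ?case by simp
next
  case (DExists \<phi>)
  have "rename (lift_ren f) \<phi> = rename (lift_ren g) \<phi>"
  proof (rule DExists.IH)
    fix n assume "n \<in> free_vars \<phi>"
    then show "lift_ren f n = lift_ren g n"
      using DExists.prems by (cases n) (simp_all add: lift_ren_def)
  qed
  then show ?case by simp
next
  case (Neg \<phi>)
  have "rename f \<phi> = rename g \<phi>"
    by (rule Neg.IH) (simp add: Neg.prems)
  then show ?case by simp
qed simp_all

lemma psubst_cong: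
  "(\<And>n. n \<in> free_vars \<phi> \<Longrightarrow> s n = t n) \<Longrightarrow> psubst s \<phi> = psubst t \<phi>"
proof (induction \<phi> arbitrary: s t)
  case (And \<phi> \<psi>)
  have "psubst s \<phi> = psubst t \<phi>" "psubst s \<psi> = psubst t \<psi>"
    by (rule And.IH, simp add: And.prems)+
  then show ?case by simp
next
  case (Or \<phi> \<psi>)
  have "psubst s \<phi> = psubst t \<phi>" "psubst s \<psi> = psubst t \<psi>"
    by (rule Or.IH, simp add: Or.prems)+
  then show ?case by simp
next
  case (DForall \<phi>)
  have "psubst (lift_subst s) \<phi> = psubst (lift_subst t) \<phi>"
  proof (rule DForall.IH)
    fix n assume "n \<in> free_vars \<phi>"
    then show "lift_subst s n = lift_subst t n"
      using DForall.prems by (cases n) (simp_all add: lift_subst_def)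
  qed
  then show ?case by simp
next
  case (DExists \<phi>)
  have "psubst (lift_subst s) \<phi> = psubst (lift_subst t) \<phi>"
  proof (rule DExists.IH)
    fix n assume "n \<in> free_vars \<phi>"
    then show "lift_subst s n = lift_subst t n"
      using DExists.prems by (cases n) (simp_all add: lift_subst_def)
  qed
  then show ?case by simp
next
  case (Neg \<phi>)
  have "psubst s \<phi> = psubst t \<phi>"
    by (rule Neg.IH) (simp add: Neg.prems)
  then show ?case by simp
qed simp_all

lemma lift_ren_comp: "lift_ren f \<circ> lift_ren g = lift_ren (f \<circ> g)"
  by (auto simp: lift_ren_def fun_eq_iff split: nat.split)

lemma rename_rename: "rename f (rename g \<phi>) = rename (f \<circ> g) \<phi>"
  by (induction \<phi> arbitrary: f g) (auto simp: lift_ren_comp)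

lemma lift_subst_ren: "lift_subst s \<circ> lift_ren f = lift_subst (s \<circ> f)"
  by (auto simp: lift_ren_def lift_subst_def fun_eq_iff split: nat.split)

lemma psubst_rename: "psubst s (rename f \<phi>) = psubst (s \<circ> f) \<phi>"
  by (induction \<phi> arbitrary: s f) (auto simp: lift_subst_ren)

lemma lift_ren_subst: "rename (lift_ren f) \<circ> lift_subst s = lift_subst (rename f \<circ> s)"
  by (auto simp: lift_ren_def lift_subst_def fun_eq_iff rename_rename o_def split: nat.split)

lemma rename_psubst: "rename f (psubst s \<phi>) = psubst (rename f \<circ> s) \<phi>"
  by (induction \<phi> arbitrary: s f) (auto simp: lift_ren_subst)

lemma lift_subst_Var: "lift_subst (Var \<circ> f) = Var \<circ> lift_ren f"
  by (auto simp: lift_ren_def lift_subst_def fun_eq_iff split: nat.split)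

lemma psubst_Var: "psubst (Var \<circ> f) \<phi> = rename f \<phi>"
  by (induction \<phi> arbitrary: f) (auto simp: lift_subst_Var)

lemma Suc_in_lift_ren_image: "Suc x \<in> lift_ren f ` A \<longleftrightarrow> (\<exists>n. Suc n \<in> A \<and> x = f n)"
proof
  assume "Suc x \<in> lift_ren f ` A"
  then obtain m where "m \<in> A" "Suc x = lift_ren f m" by blast
  then show "\<exists>n. Suc n \<in> A \<and> x = f n"
    by (cases m) (auto simp: lift_ren_def)
next
  assume "\<exists>n. Suc n \<in> A \<and> x = f n"
  then obtain n where "Suc n \<in> A" "x = f n" by blast
  then show "Suc x \<in> lift_ren f ` A"
    by (intro image_eqI[of _ _ "Suc n"]) (simp_all add: lift_ren_def)
qed

lemma free_vars_rename: "free_vars (rename f \<phi>) = f ` free_vars \<phi>"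
  by (induction \<phi> arbitrary: f) (auto simp: Suc_in_lift_ren_image)

lemma finite_free_vars: "finite (free_vars \<phi>)"
proof (induction \<phi>)
  case (DForall \<phi>)
  have "{x. Suc x \<in> free_vars \<phi>} = Suc -` free_vars \<phi>" by auto
  with DForall show ?case by (simp add: finite_vimageI)
next
  case (DExists \<phi>)
  have "{x. Suc x \<in> free_vars \<phi>} = Suc -` free_vars \<phi>" by auto
  with DExists show ?case by (simp add: finite_vimageI)
qed auto

lemma free_vars_big [simp]:
  "free_vars (big_and x \<phi>) = free_vars \<phi> - {x}"
  "free_vars (big_or x \<phi>) = free_vars \<phi> - {x}"
  by (auto simp: big_and_def big_or_def abstract_def free_vars_rename image_iff)

lemma abstract_alpha:
  assumes "y \<notin> free_vars \<phi> - {x}"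
  shows "abstract y (\<phi>[x ::= Var y]) = abstract x \<phi>"
proof -
  have "Var(x := Var y) = Var \<circ> id(x := y)" by auto
  then have "\<phi>[x ::= Var y] = rename (id(x := y)) \<phi>"
    by (simp add: subst_def psubst_Var)
  then show ?thesis
    using assms by (auto simp: abstract_def rename_rename intro!: rename_cong)
qed

lemma big_alpha:
  assumes "y \<notin> free_vars \<phi> - {x}"
  shows "big_and y (\<phi>[x ::= Var y]) = big_and x \<phi>"
    and "big_or y (\<phi>[x ::= Var y]) = big_or x \<phi>"
  using abstract_alpha[OF assms] by (simp_all add: big_and_def big_or_def)

lemma abstract_subst:
  assumes "y \<noteq> x" "y \<notin> free_vars \<gamma>"
  shows "psubst (lift_subst (Var(x := \<gamma>))) (abstract y \<phi>) = abstract y (\<phi>[x ::= \<gamma>])"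
proof -
  have "rename Suc \<gamma> = rename (\<lambda>n. if n = y then 0 else Suc n) \<gamma>"
    using assms(2) by (auto intro!: rename_cong)
  then show ?thesis
    using assms(1)
    by (auto simp: abstract_def subst_def psubst_rename rename_psubst lift_subst_def
        intro!: psubst_cong)
qed

lemma subst_simps:
  "(Var z)[x ::= \<gamma>] = (if z = x then \<gamma> else Var z)"
  "Zero[x ::= \<gamma>] = Zero"
  "One[x ::= \<gamma>] = One"
  "(And \<phi> \<psi>)[x ::= \<gamma>] = And (\<phi>[x ::= \<gamma>]) (\<psi>[x ::= \<gamma>])"
  "(Or \<phi> \<psi>)[x ::= \<gamma>] = Or (\<phi>[x ::= \<gamma>]) (\<psi>[x ::= \<gamma>])"
  "(Neg \<phi>)[x ::= \<gamma>] = Neg (\<phi>[x ::= \<gamma>])"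
  "y \<noteq> x \<Longrightarrow> y \<notin> free_vars \<gamma> \<Longrightarrow> (big_and y \<phi>)[x ::= \<gamma>] = big_and y (\<phi>[x ::= \<gamma>])"
  "y \<noteq> x \<Longrightarrow> y \<notin> free_vars \<gamma> \<Longrightarrow> (big_or y \<phi>)[x ::= \<gamma>] = big_or y (\<phi>[x ::= \<gamma>])"
  using abstract_subst[of y x \<gamma> \<phi>]
  by (simp_all add: subst_def big_and_def big_or_def)

lemma abstract_surj:
  assumes "Suc x \<notin> free_vars \<beta>"
  shows "\<exists>\<phi>. \<beta> = abstract x \<phi>"
proof -
  have "rename id \<beta> = \<beta>" for \<beta>
  proof -
    have "lift_ren id = id" by (auto simp: lift_ren_def fun_eq_iff split: nat.split)
    then show ?thesis by (induction \<beta>) auto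
  qed
  moreover have "abstract x (rename (case_nat x id) \<beta>) = rename id \<beta>"
    unfolding abstract_def rename_rename
    using assms by (intro rename_cong) (auto split: nat.split)
  ultimately show ?thesis by metis
qed

lemma big_surj:
  "x \<notin> free_vars (DForall \<beta>) \<Longrightarrow> \<exists>\<phi>. DForall \<beta> = big_and x \<phi>"
  "x \<notin> free_vars (DExists \<beta>) \<Longrightarrow> \<exists>\<phi>. DExists \<beta> = big_or x \<phi>"
  using abstract_surj[of x \<beta>] by (auto simp: big_and_def big_or_def)


section \<open>The sequent calculus\<close>

datatype annotated = AL form  ("_\<^sup>L" [1000] 999) | AR form  ("_\<^sup>R" [1000] 999)

primrec free_vars_ann :: "annotated \<Rightarrow> var set" where
  "free_vars_ann (\<phi>\<^sup>L) = free_vars \<phi>"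
| "free_vars_ann (\<phi>\<^sup>R) = free_vars \<phi>"

text \<open>
  A context (a set of zero or one annotated formula) is an \<open>annotated option\<close>, read as a set
  through \<open>set_option\<close>; so every derivable sequent has at most two elements.

  \<open>And\<close> and \<open>Or\<close> are commutative connectives of orthologic, so the rules for \<open>And\<close> on the left
  and \<open>Or\<close> on the right apply to either component; otherwise not even \<open>And \<phi> \<psi> \<turnstile> \<psi>\<close> would be
  derivable.

  The eigenvariable \<open>x'\<close> may not be free in the whole conclusion, i.e. neither in the context nor
  in the quantified formula; \<open>x' = x\<close> is allowed. Asking only for freshness in the context would
  be unsound: it would yield \<open>\<And>x. x \<or> \<not>y\<close> from \<open>y \<or> \<not>y\<close>.
\<close>

inductive derivable :: "annotated set \<Rightarrow> bool" where
  Hyp: "derivable {\<phi>\<^sup>L, \<phi>\<^sup>R}"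
| Cut: "derivable (set_option \<Gamma> \<union> {\<psi>\<^sup>R}) \<Longrightarrow> derivable ({\<psi>\<^sup>L} \<union> set_option \<Delta>) \<Longrightarrow>
    derivable (set_option \<Gamma> \<union> set_option \<Delta>)"
| Weaken: "derivable (set_option \<Gamma>) \<Longrightarrow> derivable (set_option \<Gamma> \<union> set_option \<Delta>)"
| LeftAnd1: "derivable (set_option \<Gamma> \<union> {\<phi>\<^sup>L}) \<Longrightarrow> derivable (set_option \<Gamma> \<union> {(And \<phi> \<psi>)\<^sup>L})"
| LeftAnd2: "derivable (set_option \<Gamma> \<union> {\<psi>\<^sup>L}) \<Longrightarrow> derivable (set_option \<Gamma> \<union> {(And \<phi> \<psi>)\<^sup>L})"
| RightAnd: "derivable (set_option \<Gamma> \<union> {\<phi>\<^sup>R}) \<Longrightarrow> derivable (set_option \<Gamma> \<union> {\<psi>\<^sup>R}) \<Longrightarrow>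
    derivable (set_option \<Gamma> \<union> {(And \<phi> \<psi>)\<^sup>R})"
| LeftOr: "derivable (set_option \<Gamma> \<union> {\<phi>\<^sup>L}) \<Longrightarrow> derivable (set_option \<Gamma> \<union> {\<psi>\<^sup>L}) \<Longrightarrow>
    derivable (set_option \<Gamma> \<union> {(Or \<phi> \<psi>)\<^sup>L})"
| RightOr1: "derivable (set_option \<Gamma> \<union> {\<phi>\<^sup>R}) \<Longrightarrow> derivable (set_option \<Gamma> \<union> {(Or \<phi> \<psi>)\<^sup>R})"
| RightOr2: "derivable (set_option \<Gamma> \<union> {\<psi>\<^sup>R}) \<Longrightarrow> derivable (set_option \<Gamma> \<union> {(Or \<phi> \<psi>)\<^sup>R})"
| LeftNot: "derivable (set_option \<Gamma> \<union> {\<phi>\<^sup>R}) \<Longrightarrow> derivable (set_option \<Gamma> \<union> {(Neg \<phi>)\<^sup>L})"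
| RightNot: "derivable (set_option \<Gamma> \<union> {\<phi>\<^sup>L}) \<Longrightarrow> derivable (set_option \<Gamma> \<union> {(Neg \<phi>)\<^sup>R})"
| LeftForall: "derivable (set_option \<Gamma> \<union> {(\<phi>[x ::= \<gamma>])\<^sup>L}) \<Longrightarrow>
    derivable (set_option \<Gamma> \<union> {(big_and x \<phi>)\<^sup>L})"
| RightForall: "derivable (set_option \<Gamma> \<union> {(\<phi>[x ::= Var x'])\<^sup>R}) \<Longrightarrow>
    x' \<notin> \<Union> (free_vars_ann ` set_option \<Gamma>) \<Longrightarrow> x' \<notin> free_vars (big_and x \<phi>) \<Longrightarrow>
    derivable (set_option \<Gamma> \<union> {(big_and x \<phi>)\<^sup>R})"
| LeftExists: "derivable (set_option \<Gamma> \<union> {(\<phi>[x ::= Var x'])\<^sup>L}) \<Longrightarrow>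
    x' \<notin> \<Union> (free_vars_ann ` set_option \<Gamma>) \<Longrightarrow> x' \<notin> free_vars (big_or x \<phi>) \<Longrightarrow>
    derivable (set_option \<Gamma> \<union> {(big_or x \<phi>)\<^sup>L})"
| RightExists: "derivable (set_option \<Gamma> \<union> {(\<phi>[x ::= \<gamma>])\<^sup>R}) \<Longrightarrow>
    derivable (set_option \<Gamma> \<union> {(big_or x \<phi>)\<^sup>R})"

definition entails :: "form \<Rightarrow> form \<Rightarrow> bool"  (infix "\<turnstile>" 50) where
  "\<phi> \<turnstile> \<psi> \<longleftrightarrow> derivable {\<phi>\<^sup>L, \<psi>\<^sup>R}"

definition admits_quantifier_elimination :: "(form \<Rightarrow> form \<Rightarrow> bool) \<Rightarrow> bool" where
  "admits_quantifier_elimination ent \<longleftrightarrow>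
    (\<forall>Q. \<exists>E. quantifier_free E \<and> ent Q E \<and> ent E Q)"

end

(*
  QOL is sound for every nontrivial complete ortholattice, with the quantifiers read as infimum and
  supremum over all elements. Take the benzene ring, the six-element ortholattice with bottom, top
  and the two chains a < b and -b < -a, and send every variable to a. A quantifier-free formula
  then stays in the subalgebra {bottom, a, -a, top}. The term -x \<sqinter> (a \<squnion> x) equals b at x = -b and is
  at most b everywhere, so the existential formula takes the value b, which lies outside this
  subalgebra.
*)
theory Submission
  imports Defs "HOL-Library.Complemented_Lattices" "HOL-Library.Finite_Lattice"
begin

section \<open>Semantics of formulas in a complete ortholattice\<close>

primrec eval :: "(var \<Rightarrow> 'a::complete_orthocomplemented_lattice) \<Rightarrow> form \<Rightarrow> 'a" where
  "eval v (Var x) = v x"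
| "eval v Zero = bot"
| "eval v One = top"
| "eval v (And \<phi> \<psi>) = inf (eval v \<phi>) (eval v \<psi>)"
| "eval v (Or \<phi> \<psi>) = sup (eval v \<phi>) (eval v \<psi>)"
| "eval v (Neg \<phi>) = - eval v \<phi>"
| "eval v (DForall \<phi>) = (INF d. eval (case_nat d v) \<phi>)"
| "eval v (DExists \<phi>) = (SUP d. eval (case_nat d v) \<phi>)"

lemma eval_cong: "(\<And>n. n \<in> free_vars \<phi> \<Longrightarrow> v n = w n) \<Longrightarrow> eval v \<phi> = eval w \<phi>"
proof (induction \<phi> arbitrary: v w)
  case (And \<phi> \<psi>)
  have "eval v \<phi> = eval w \<phi>" "eval v \<psi> = eval w \<psi>"
    by (rule And.IH, simp add: And.prems)+
  then show ?case by simp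
next
  case (Or \<phi> \<psi>)
  have "eval v \<phi> = eval w \<phi>" "eval v \<psi> = eval w \<psi>"
    by (rule Or.IH, simp add: Or.prems)+
  then show ?case by simp
next
  case (Neg \<phi>)
  have "eval v \<phi> = eval w \<phi>"
    by (rule Neg.IH) (simp add: Neg.prems)
  then show ?case by simp
next
  case (DForall \<phi>)
  have "eval (case_nat d v) \<phi> = eval (case_nat d w) \<phi>" for d
    by (rule DForall.IH) (auto simp: DForall.prems split: nat.split)
  then show ?case by simp
next
  case (DExists \<phi>)
  have "eval (case_nat d v) \<phi> = eval (case_nat d w) \<phi>" for d
    by (rule DExists.IH) (auto simp: DExists.prems split: nat.split)
  then show ?case by simp
qed simp_all

lemma case_nat_lift_ren: "case_nat d v \<circ> lift_ren f = case_nat d (v \<circ> f)"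
  by (auto simp: lift_ren_def fun_eq_iff split: nat.split)

lemma eval_rename: "eval v (rename f \<phi>) = eval (v \<circ> f) \<phi>"
  by (induction \<phi> arbitrary: v f) (simp_all add: case_nat_lift_ren)

text \<open>The shift by \<open>Suc\<close> inside \<open>lift_subst\<close> skips the new entry
  \<open>d\<close>, so the substituted formulas keep their values under the binder.\<close>

lemma eval_lift_subst: "eval (case_nat d v) \<circ> lift_subst s = case_nat d (eval v \<circ> s)"
  by (auto simp: lift_subst_def fun_eq_iff eval_rename o_def split: nat.split)

lemma eval_psubst: "eval v (psubst s \<phi>) = eval (eval v \<circ> s) \<phi>"
  by (induction \<phi> arbitrary: v s) (simp_all add: eval_lift_subst)

lemma eval_subst: "eval v (\<phi>[x ::= \<gamma>]) = eval (v(x := eval v \<gamma>)) \<phi>"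
proof -
  have "eval v \<circ> Var(x := \<gamma>) = v(x := eval v \<gamma>)" by auto
  then show ?thesis by (simp add: subst_def eval_psubst)
qed

text \<open>Bridge from indices to named binders: \<open>x\<close> becomes index 0 and reads
  \<open>d\<close>, every other variable is shifted past it.\<close>

lemma eval_abstract: "eval (case_nat d v) (abstract x \<phi>) = eval (v(x := d)) \<phi>"
proof -
  have "case_nat d v \<circ> (\<lambda>n. if n = x then 0 else Suc n) = v(x := d)" by auto
  then show ?thesis by (simp add: abstract_def eval_rename)
qed

lemma eval_big:
  "eval v (big_and x \<phi>) = (INF d. eval (v(x := d)) \<phi>)"
  "eval v (big_or x \<phi>) = (SUP d. eval (v(x := d)) \<phi>)"
  by (simp_all add: big_and_def big_or_def eval_abstract)

text \<open>The assignments compared can differ only at \<open>x'\<close>, which is either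
  \<open>x\<close> itself or not free in \<open>\<phi>\<close>.\<close>

lemma eval_subst_fresh:
  assumes "x' \<notin> free_vars \<phi> - {x}"
  shows "eval (v(x' := d)) (\<phi>[x ::= Var x']) = eval (v(x := d)) \<phi>"
  using assms by (auto simp: eval_subst intro!: eval_cong)

section \<open>Validity of sequents and soundness\<close>

text \<open>A right formula counts negatively, so that a sequent says that its two members are
  orthogonal. The empty context gets the value \<open>top\<close>, being orthogonal to exactly \<open>bot\<close>.\<close>

primrec eval_ann :: "(var \<Rightarrow> 'a::complete_orthocomplemented_lattice) \<Rightarrow> annotated \<Rightarrow> 'a" where
  "eval_ann v (\<phi>\<^sup>L) = eval v \<phi>"
| "eval_ann v (\<phi>\<^sup>R) = - eval v \<phi>"

definition eval_ctxt ::
    "(var \<Rightarrow> 'a::complete_orthocomplemented_lattice) \<Rightarrow> annotated option \<Rightarrow> 'a" where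
  "eval_ctxt v \<Gamma> = (case \<Gamma> of None \<Rightarrow> top | Some a \<Rightarrow> eval_ann v a)"

text \<open>\<open>a\<close> and \<open>b\<close> may coincide: a one-element sequent says that its
  member is orthogonal to itself, hence \<open>bot\<close>. The empty sequent never holds.\<close>

definition holds ::
    "(var \<Rightarrow> 'a::complete_orthocomplemented_lattice) \<Rightarrow> annotated set \<Rightarrow> bool" where
  "holds v S \<longleftrightarrow> (\<exists>a b. S = {a, b} \<and> eval_ann v a \<le> - eval_ann v b)"

lemma le_uminus_self_iff:
  fixes a :: "'a::orthocomplemented_lattice"
  shows "a \<le> - a \<longleftrightarrow> a = bot"
  by (metis bot.extremum inf.orderE inf_compl_bot)

lemma le_uminus_commute:
  fixes a b :: "'a::orthocomplemented_lattice"
  shows "a \<le> - b \<longleftrightarrow> b \<le> - a"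
  using compl_le_swap1 by blast

text \<open>Orthogonality is symmetric, so it does not depend on the order in which the set lists
  its members.\<close>

lemma holds_pair: "holds v {a, b} \<longleftrightarrow> eval_ann v a \<le> - eval_ann v b"
  unfolding holds_def
  by (auto simp: doubleton_eq_iff dest: compl_le_swap1)

lemma holds_insert: "holds v (set_option \<Gamma> \<union> {a}) \<longleftrightarrow> eval_ctxt v \<Gamma> \<le> - eval_ann v a"
proof (cases \<Gamma>)
  case None
  have "holds v {a} \<longleftrightarrow> eval_ann v a \<le> - eval_ann v a"
    using holds_pair[of v a a] by simp
  also have "\<dots> \<longleftrightarrow> top \<le> - eval_ann v a"
    by (simp add: le_uminus_self_iff le_uminus_commute[of top] bot_unique)
  finally show ?thesis using None by (simp add: eval_ctxt_def)
next
  case (Some b)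
  then show ?thesis using holds_pair[of v b a] by (simp add: eval_ctxt_def insert_commute)
qed

text \<open>Nontriviality settles the case of two empty contexts: the empty sequent fails, and so
  must \<open>top \<le> - top\<close>.\<close>

lemma holds_Un:
  assumes "(bot :: 'a::complete_orthocomplemented_lattice) \<noteq> top"
  shows "holds (v :: var \<Rightarrow> 'a) (set_option \<Gamma> \<union> set_option \<Delta>) \<longleftrightarrow>
    eval_ctxt v \<Gamma> \<le> - eval_ctxt v \<Delta>"
proof (cases \<Delta>)
  case None
  show ?thesis
  proof (cases \<Gamma>)
    case None
    then show ?thesis
      using \<open>\<Delta> = None\<close> assms by (auto simp: holds_def eval_ctxt_def top_unique)
  next
    case (Some a)
    then show ?thesis
      using \<open>\<Delta> = None\<close> holds_insert[of v None a] le_uminus_commute[of top "eval_ann v a"]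
      by (simp add: eval_ctxt_def)
  qed
next
  case (Some b)
  then show ?thesis using holds_insert[of v \<Gamma> b] by (simp add: eval_ctxt_def)
qed

lemma eval_ctxt_fresh:
  assumes "x' \<notin> \<Union> (free_vars_ann ` set_option \<Gamma>)"
  shows "eval_ctxt (v(x' := d)) \<Gamma> = eval_ctxt v \<Gamma>"
proof (cases \<Gamma>)
  case (Some a)
  then show ?thesis
    using assms by (cases a) (auto simp: eval_ctxt_def intro!: eval_cong)
qed (simp add: eval_ctxt_def)

text \<open>The assignment stays arbitrary in the induction because the eigenvariable rules use
  their premise at every \<open>v(x' := d)\<close>.\<close>

theorem soundness:
  assumes "derivable S" and nontrivial: "(bot :: 'a::complete_orthocomplemented_lattice) \<noteq> top"
  shows "holds (v :: var \<Rightarrow> 'a) S"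
  using assms(1)
proof (induction arbitrary: v)
  case (Hyp \<phi>)
  then show ?case by (simp add: holds_pair)
next
  case (Cut \<Gamma> \<psi> \<Delta>)
  have "eval_ctxt v \<Gamma> \<le> eval v \<psi>"
    using Cut.IH(1)[of v] by (simp only: holds_insert) simp
  also have "eval v \<psi> \<le> - eval_ctxt v \<Delta>"
    using Cut.IH(2)[of v] by (simp only: Un_commute[of "{_}"] holds_insert) (simp add: compl_le_swap1)
  finally show ?case by (simp add: holds_Un[OF nontrivial])
next
  case (Weaken \<Gamma> \<Delta>)
  \<comment> \<open>The premise is read as \<open>\<Gamma>\<close> paired with an empty context,
    which forces the value \<open>bot\<close>.\<close>
  have "eval_ctxt v \<Gamma> \<le> - top"
    using Weaken.IH[of v] holds_Un[OF nontrivial, of v \<Gamma> None] by (simp add: eval_ctxt_def)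
  then show ?case by (simp add: holds_Un[OF nontrivial] bot_unique)
next
  case (RightForall \<Gamma> \<phi> x x')
  \<comment> \<open>The context does not see \<open>x'\<close>, so one value is a lower bound for
    all instances.\<close>
  have "eval_ctxt v \<Gamma> \<le> eval (v(x := d)) \<phi>" for d
  proof -
    have "eval_ctxt (v(x' := d)) \<Gamma> \<le> eval (v(x' := d)) (\<phi>[x ::= Var x'])"
      using RightForall.IH[of "v(x' := d)"] by (simp only: holds_insert) simp
    then show ?thesis
      using RightForall.hyps by (simp add: eval_ctxt_fresh eval_subst_fresh)
  qed
  then show ?case
    unfolding holds_insert by (simp add: eval_big le_INF_iff)
next
  case (LeftExists \<Gamma> \<phi> x x')
  have "eval (v(x := d)) \<phi> \<le> - eval_ctxt v \<Gamma>" for d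
  proof -
    have "eval (v(x' := d)) (\<phi>[x ::= Var x']) \<le> - eval_ctxt (v(x' := d)) \<Gamma>"
      using LeftExists.IH[of "v(x' := d)"] by (simp only: holds_insert le_uminus_commute) simp
    then show ?thesis
      using LeftExists.hyps by (simp add: eval_ctxt_fresh eval_subst_fresh)
  qed
  then have "eval v (big_or x \<phi>) \<le> - eval_ctxt v \<Gamma>"
    by (simp add: eval_big SUP_le_iff)
  then show ?case
    unfolding holds_insert by (simp add: le_uminus_commute)
next
  case (LeftForall \<Gamma> \<phi> x \<gamma>)
  have "eval v (big_and x \<phi>) \<le> eval v (\<phi>[x ::= \<gamma>])"
    unfolding eval_big eval_subst by (rule INF_lower) simp
  with LeftForall.IH[of v] show ?case
    unfolding holds_insert by (simp add: order_trans)
next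
  case (RightExists \<Gamma> \<phi> x \<gamma>)
  have "eval v (\<phi>[x ::= \<gamma>]) \<le> eval v (big_or x \<phi>)"
    unfolding eval_big eval_subst by (rule SUP_upper) simp
  with RightExists.IH[of v] show ?case
    unfolding holds_insert by (simp add: order_trans)
\<comment> \<open>The negation rules preserve the value of the annotated formula; the rules for
  \<open>And\<close> and \<open>Or\<close> follow from De Morgan and the bounds defining
  \<open>inf\<close> and \<open>sup\<close>.\<close>
qed (simp_all only: holds_insert eval_ann.simps eval.simps,
     auto simp: le_supI1 le_supI2)

corollary eval_mono:
  assumes "\<phi> \<turnstile> \<psi>" and "(bot :: 'a::complete_orthocomplemented_lattice) \<noteq> top"
  shows "eval (v :: var \<Rightarrow> 'a) \<phi> \<le> eval v \<psi>"
  using soundness[OF assms[unfolded entails_def], of v] by (simp add: holds_pair)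

section \<open>The benzene ring as a complete ortholattice\<close>

datatype benzene = Bot | A | B | NB | NA | Top

lemma UNIV_benzene: "UNIV = {Bot, A, B, NB, NA, Top}"
  using benzene.exhaust by blast

instance benzene :: finite
  by standard (simp add: UNIV_benzene)

instantiation benzene :: "{bounded_lattice, uminus, minus}"
begin

text \<open>Orthomodularity fails for this order: \<open>A \<le> B\<close>, yet
  \<open>sup A (inf (- A) B)\<close> is only \<open>A\<close>.\<close>

definition less_eq_benzene :: "benzene \<Rightarrow> benzene \<Rightarrow> bool" where
  "(x :: benzene) \<le> y \<longleftrightarrow> x = y \<or> x = Bot \<or> y = Top \<or> (x, y) \<in> {(A, B), (NB, NA)}"

definition less_benzene :: "benzene \<Rightarrow> benzene \<Rightarrow> bool" where
  "(x :: benzene) < y \<longleftrightarrow> x \<le> y \<and> x \<noteq> y"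

definition bot_benzene :: benzene where "bot = Bot"

definition top_benzene :: benzene where "top = Top"

text \<open>Incomparable elements lie on different chains and have only \<open>Bot\<close> as a
  common lower bound; dually for \<open>sup\<close>.\<close>

definition inf_benzene :: "benzene \<Rightarrow> benzene \<Rightarrow> benzene" where
  "inf (x :: benzene) y = (if x \<le> y then x else if y \<le> x then y else Bot)"

definition sup_benzene :: "benzene \<Rightarrow> benzene \<Rightarrow> benzene" where
  "sup (x :: benzene) y = (if x \<le> y then y else if y \<le> x then x else Top)"

primrec uminus_benzene :: "benzene \<Rightarrow> benzene" where
  "- Bot = Top"
| "- A = NA"
| "- B = NB"
| "- NB = B"
| "- NA = A"
| "- Top = Bot"

definition minus_benzene :: "benzene \<Rightarrow> benzene \<Rightarrow> benzene" where
  "(x :: benzene) - y = inf x (- y)"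

instance
  by standard
    (auto simp: less_eq_benzene_def less_benzene_def bot_benzene_def top_benzene_def
      inf_benzene_def sup_benzene_def split: if_splits)

end

lemmas benzene_defs = less_eq_benzene_def bot_benzene_def top_benzene_def inf_benzene_def
  sup_benzene_def minus_benzene_def

instance benzene :: orthocomplemented_lattice
proof
  fix x y :: benzene
  show "inf x (- x) = bot" "sup x (- x) = top" "- (- x) = x"
    by (cases x; simp add: benzene_defs)+
  show "x - y = inf x (- y)"
    by (fact minus_benzene_def)
  show "- y \<le> - x" if "x \<le> y"
    using that by (cases x; cases y; simp add: benzene_defs)
qed

instantiation benzene :: finite_lattice_complete
begin

text \<open>The fold is the form that \<open>finite_lattice_complete\<close> prescribes;
  completeness then comes from finiteness.\<close>

definition Inf_benzene :: "benzene set \<Rightarrow> benzene" where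
  "Inf (S :: benzene set) = Finite_Set.fold inf top S"

definition Sup_benzene :: "benzene set \<Rightarrow> benzene" where
  "Sup (S :: benzene set) = Finite_Set.fold sup bot S"

instance
proof
  show "(bot :: benzene) = Inf_fin UNIV"
    \<comment> \<open>\<open>bot\<close> is a member of \<open>UNIV\<close>, so the meet of all
      elements lies below it.\<close>
    by (rule sym, rule bot_unique[THEN iffD1], rule Inf_fin.coboundedI) simp_all
  show "(top :: benzene) = Sup_fin UNIV"
    by (rule sym, rule top_unique[THEN iffD1], rule Sup_fin.coboundedI) simp_all
qed (simp_all add: Inf_benzene_def Sup_benzene_def)

end

instance benzene :: complete_orthocomplemented_lattice ..

section \<open>Values in the benzene ring and the refutation\<close>

lemma eval_quantifier_free_benzene:
  "quantifier_free E \<Longrightarrow> eval (\<lambda>_. A) E \<in> {Bot, A, NA, Top}"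
  by (induction E) (auto simp: benzene_defs)

text \<open>For \<open>x\<close> equal to \<open>Bot\<close>, \<open>A\<close>, \<open>B\<close>,
  \<open>NB\<close>, \<open>NA\<close>, \<open>Top\<close> the body takes the values
  \<open>A\<close>, \<open>Bot\<close>, \<open>Bot\<close>, \<open>B\<close>, \<open>A\<close>,
  \<open>Bot\<close>, whose join is \<open>B\<close>.\<close>

lemma eval_counterexample_benzene:
  assumes "x \<noteq> y"
  shows "eval (\<lambda>_. A) (big_or x (And (Neg (Var x)) (Or (Var y) (Var x)))) = B"
  using assms by (simp add: eval_big UNIV_benzene) (simp add: benzene_defs)

theorem theorem2:
  shows "\<not> admits_quantifier_elimination (\<turnstile>) \<and>
    (\<forall>x y :: var. x \<noteq> y \<longrightarrow>
      \<not> (\<exists>E. quantifier_free E \<and>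
            E \<turnstile> big_or x (And (Neg (Var x)) (Or (Var y) (Var x))) \<and>
            big_or x (And (Neg (Var x)) (Or (Var y) (Var x))) \<turnstile> E))"
proof -
  let ?Q = "\<lambda>x y :: var. big_or x (And (Neg (Var x)) (Or (Var y) (Var x)))"
  have no_qf: False if "x \<noteq> y" "quantifier_free E" "E \<turnstile> ?Q x y" "?Q x y \<turnstile> E" for x y E
  proof -
    have "(bot :: benzene) \<noteq> top"
      by (simp add: benzene_defs)
    then have "eval (\<lambda>_. A) E = eval (\<lambda>_. A) (?Q x y)"
      using that by (intro antisym eval_mono)
    then show False
      using eval_quantifier_free_benzene[OF that(2)] eval_counterexample_benzene[OF that(1)] by simp
  qed
  have "\<not> admits_quantifier_elimination (\<turnstile>)"
  proof
    assume "admits_quantifier_elimination (\<turnstile>)"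
    then obtain E where "quantifier_free E" "?Q 0 1 \<turnstile> E" "E \<turnstile> ?Q 0 1"
      unfolding admits_quantifier_elimination_def by blast
    then show False using no_qf[of 0 1 E] by simp
  qed
  with no_qf show ?thesis by blast
qed

end
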